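(* Let $I\subset[0,\infty)$ be an interval, let $a,b\in I$ with $a<b$, and let $f:I\to\mathbb{R}$ be differentiable on the interior $I^{\circ}$ of $I$ and at $a$ and $b$, with $f'\in L[a,b]$. Let $q\ge1$ and suppose that $|f'|^q$ is convex on $[a,b]$. Then for every division $d: a=x_0<x_1<\dots<x_{n-1}<x_n=b$ of $[a,b]$, the midpoint error $E(f,d)$ satisfies $$|E(f,d)|\le \frac18\Big(\frac13\Big)^{\frac1q}\sum_{i=0}^{n-1}(x_{i+1}-x_i)^2\left[\left(|f'(x_i)|^q+3|f'(x_{i+1})|^q\right)^{\frac1q}+\left(3|f'(x_i)|^q+|f'(x_{i+1})|^q\right)^{\frac1q}\right].$$
   Context: For a division $d: a=x_0<x_1<\dots<x_n=b$, the midpoint sum is $T(f,d)=\sum_{i=0}^{n-1} f\left(\frac{x_i+x_{i+1}}{2}\right)(x_{i+1}-x_i)$ and the error is $E(f,d)=\int_a^b f(x)\,dx-T(f,d)$. $L[a,b]$ denotes the Lebesgue integrable functions on $[a,b]$. If $a$ or $b$ is an endpoint of $I$, differentiability there is one-sided (within $I$). *)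

theory Defs
  imports "HOL-Analysis.Analysis"
begin

text \<open>A division \<open>a = x 0 < \<dots> < x n = b\<close> is given by the number \<open>n\<close> of its subintervals and a
  sequence of points; the values \<open>x i\<close> for \<open>i > n\<close> are irrelevant.\<close>

definition is_division :: "real \<Rightarrow> real \<Rightarrow> nat \<Rightarrow> (nat \<Rightarrow> real) \<Rightarrow> bool" where
  "is_division a b n x \<longleftrightarrow> x 0 = a \<and> x n = b \<and> (\<forall>i<n. x i < x (Suc i))"

definition midpoint_sum :: "(real \<Rightarrow> real) \<Rightarrow> nat \<Rightarrow> (nat \<Rightarrow> real) \<Rightarrow> real" where
  "midpoint_sum f n x = (\<Sum>i<n. f ((x i + x (Suc i)) / 2) * (x (Suc i) - x i))"

definition midpoint_error :: "(real \<Rightarrow> real) \<Rightarrow> nat \<Rightarrow> (nat \<Rightarrow> real) \<Rightarrow> real" where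
  "midpoint_error f n x = integral {x 0..x n} f - midpoint_sum f n x"

end

theory Submission
  imports Defs
begin

text \<open>On the left half \<open>[c, m]\<close> of a subinterval the midpoint error is at most the integral of
  \<open>(t - c) \<bar>f' t\<bar>\<close>. With respect to the weight \<open>t - c\<close>, the interval \<open>[c, m]\<close> has total mass
  \<open>(m - c)\<^sup>2 / 2\<close> and barycentre \<open>c + 2 (m - c) / 3\<close>. Convexity bounds \<open>\<bar>f'\<bar> powr q\<close> by an affine
  function, and the tangent to the concave function \<open>\<lambda>u. u powr (1 / q)\<close> at the value of that
  function at the barycentre turns this into an affine bound for \<open>\<bar>f'\<bar>\<close>, whose slope does not
  contribute to the integral. With \<open>A\<close>, \<open>B\<close> the values of \<open>\<bar>f'\<bar> powr q\<close> at the endpoints of the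
  subinterval, the two halves contribute \<open>((2 A + B) / 3) powr (1 / q)\<close> and
  \<open>((A + 2 B) / 3) powr (1 / q)\<close>; these are at most \<open>((3 A + B) / 3) powr (1 / q)\<close> and
  \<open>((A + 3 B) / 3) powr (1 / q)\<close>.\<close>

text \<open>Weighted AM-GM gives \<open>u powr p * v powr (1 - p) \<le> p * u + (1 - p) * v\<close>;
  multiplying by \<open>v powr (p - 1)\<close> turns the right side into the tangent at
  \<open>v\<close>.\<close>

lemma powr_le_tangent:
  fixes p u v :: real
  assumes "0 \<le> p" "p \<le> 1" "0 \<le> u" "0 < v"
  shows "u powr p \<le> v powr p + p * v powr (p - 1) * (u - v)"
proof (cases "u = 0")
  \<comment> \<open>Young's inequality is applied to positive \<open>u\<close> only. At
    \<open>u = 0\<close> the left side is \<open>0\<close>, even for \<open>p = 0\<close> because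
    \<open>0 powr 0 = 0\<close>, and the tangent has the value
    \<open>(1 - p) * v powr p\<close>.\<close>
  case True
  have "v powr (p - 1) * v = v powr p"
    using assms by (simp add: powr_mult_base mult.commute)
  then have "p * v powr (p - 1) * (u - v) = - (p * v powr p)"
    using True by (simp add: mult.assoc)
  moreover have "p * v powr p \<le> 1 * v powr p"
    using assms by (intro mult_right_mono) auto
  ultimately have "0 \<le> v powr p + p * v powr (p - 1) * (u - v)"
    by linarith
  then show ?thesis using True by simp
next
  case False
  have e: "v powr (p - 1) * v = v powr p"
    using assms by (simp add: powr_mult_base mult.commute)
  have i: "v powr (1 - p) * v powr (p - 1) = 1"
    using assms by (simp flip: powr_add)
  have "u powr p * v powr (1 - p) \<le> p * u + (1 - p) * v"
    using Youngs_inequality_0[of p "1 - p" u v] assms False by simp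
  then have "u powr p * v powr (1 - p) * v powr (p - 1) \<le> (p * u + (1 - p) * v) * v powr (p - 1)"
    by (intro mult_right_mono) auto
  then have "u powr p \<le> (p * u + (1 - p) * v) * v powr (p - 1)"
    using i by (simp add: mult.assoc)
  also have "\<dots> = v powr (p - 1) * v + p * v powr (p - 1) * (u - v)"
    by (simp add: algebra_simps)
  finally show ?thesis using e by simp
qed

text \<open>Both \<open>F - f\<close> and \<open>F + f\<close> have a nonnegative derivative, so the
  mean value theorem makes both increments nonnegative. This compares increments without writing
  \<open>f\<close> as an integral of \<open>f'\<close>.\<close>

lemma abs_diff_le_if_deriv_le:
  fixes f F f' F' :: "real \<Rightarrow> real"
  assumes "s \<le> t"
    and f: "\<And>x. x \<in> {s..t} \<Longrightarrow> (f has_real_derivative f' x) (at x within {s..t})"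
    and F: "\<And>x. x \<in> {s..t} \<Longrightarrow> (F has_real_derivative F' x) (at x within {s..t})"
    and le: "\<And>x. x \<in> {s..t} \<Longrightarrow> \<bar>f' x\<bar> \<le> F' x"
  shows "\<bar>f t - f s\<bar> \<le> F t - F s"
proof -
  have "\<exists>x\<in>{s..t}. (F t - f t) - (F s - f s) = (*) (F' x - f' x) (t - s)"
    using assms(1) by (intro mvt_very_simple)
      (auto intro!: DERIV_diff f F simp flip: has_field_derivative_def)
  then obtain y where y: "y \<in> {s..t}" "(F t - f t) - (F s - f s) = (F' y - f' y) * (t - s)"
    by blast
  have "\<exists>x\<in>{s..t}. (F t + f t) - (F s + f s) = (*) (F' x + f' x) (t - s)"
    using assms(1) by (intro mvt_very_simple)
      (auto intro!: DERIV_add f F simp flip: has_field_derivative_def)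
  then obtain z where z: "z \<in> {s..t}" "(F t + f t) - (F s + f s) = (F' z + f' z) * (t - s)"
    by blast
  have "0 \<le> (F' y - f' y) * (t - s)" "0 \<le> (F' z + f' z) * (t - s)"
    using le[OF y(1)] le[OF z(1)] assms(1) by (auto intro!: mult_nonneg_nonneg)
  then show ?thesis using y(2) z(2) by linarith
qed

lemma endpoint_error_affine:
  fixes f f' :: "real \<Rightarrow> real"
  assumes "c \<le> m"
    and f: "\<And>t. t \<in> {c..m} \<Longrightarrow> (f has_real_derivative f' t) (at t within {c..m})"
    and le: "\<And>t. t \<in> {c..m} \<Longrightarrow> \<bar>f' t\<bar> \<le> r + k * (t - (c + 2 * (m - c) / 3))"
  shows "\<bar>integral {c..m} f - (m - c) * f m\<bar> \<le> (m - c)\<^sup>2 / 2 * r"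
proof -
  define z where "z = c + 2 * (m - c) / 3"
  \<comment> \<open>\<open>F\<close> is a primitive of the affine bound and \<open>G\<close> one of
    \<open>F m - F t\<close>. Integrating \<open>F m - F t\<close> over \<open>{c..m}\<close>
    amounts to integrating \<open>F'\<close> against the weight \<open>t - c\<close>.\<close>
  define F where "F t = r * t + k * (t - z)\<^sup>2 / 2" for t
  define G where "G t = F m * t - r * t\<^sup>2 / 2 - k * (t - z) ^ 3 / 6" for t
  have F': "(F has_real_derivative r + k * (t - z)) (at t within S)" for t S
    unfolding F_def by (auto intro!: derivative_eq_intros)
  have G': "(G has_real_derivative F m - F t) (at t within S)" for t S
    unfolding G_def F_def[of t]
    by (auto intro!: derivative_eq_intros simp: power2_eq_square)
  have I: "((\<lambda>t. F m - F t) has_integral G m - G c) {c..m}"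
    using assms(1) G' by (intro fundamental_theorem_of_calculus)
      (auto simp flip: has_real_derivative_iff_has_vector_derivative)
  \<comment> \<open>With \<open>h = m - c\<close> one has \<open>m - z = h / 3\<close> and
    \<open>c - z = - 2 * h / 3\<close>; the terms in \<open>k\<close> are then
    \<open>k * h ^ 3 / 18\<close> twice with opposite signs.\<close>
  have "G m - G c = (m - c)\<^sup>2 / 2 * r"
    unfolding G_def F_def z_def by (simp add: field_simps power2_eq_square power3_eq_cube)
  have pt: "\<bar>f m - f t\<bar> \<le> F m - F t" if "t \<in> {c..m}" for t
  proof (rule abs_diff_le_if_deriv_le[where f' = f' and F' = "\<lambda>t. r + k * (t - z)"])
    show "t \<le> m" using that by simp
    fix x assume "x \<in> {t..m}"
    then have x: "x \<in> {c..m}" using that by auto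
    show "(f has_real_derivative f' x) (at x within {t..m})"
      using f[OF x] that by (rule_tac has_field_derivative_subset) auto
    show "\<bar>f' x\<bar> \<le> r + k * (x - z)" using le[OF x] by (simp add: z_def)
  qed (rule F')
  have "continuous_on {c..m} f"
    using f by (meson DERIV_continuous continuous_on_eq_continuous_within)
  then have fi: "f integrable_on {c..m}"
    by (rule integrable_continuous_real)
  have fm: "((\<lambda>t. f t - f m) has_integral integral {c..m} f - (m - c) * f m) {c..m}"
    using has_integral_diff[OF integrable_integral[OF fi] has_integral_const_real[of "f m" c m]]
      assms(1) by simp
  have "norm (integral {c..m} (\<lambda>t. f t - f m)) \<le> integral {c..m} (\<lambda>t. F m - F t)"
    using fm I pt by (intro integral_norm_bound_integral)
      (auto simp: abs_minus_commute)
  then show ?thesis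
    using \<open>G m - G c = _\<close> integral_unique[OF fm] integral_unique[OF I] by simp
qed

text \<open>The right side of \<open>le\<close> is the line with value \<open>A\<close> at
  \<open>c\<close> and \<open>B\<close> at \<open>2 * m - c\<close>, the far end of the interval
  with midpoint \<open>m\<close>. Its value at the barycentre \<open>c + 2 * (m - c) / 3\<close> is
  \<open>(2 * A + B) / 3\<close>.\<close>

lemma endpoint_error_powr:
  fixes f f' :: "real \<Rightarrow> real"
  assumes "c < m" "q \<ge> 1" "A \<ge> 0" "B \<ge> 0"
    and f: "\<And>t. t \<in> {c..m} \<Longrightarrow> (f has_real_derivative f' t) (at t within {c..m})"
    and le: "\<And>t. t \<in> {c..m} \<Longrightarrow> \<bar>f' t\<bar> powr q \<le> A + (B - A) / (2 * (m - c)) * (t - c)"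
  shows "\<bar>integral {c..m} f - (m - c) * f m\<bar> \<le> (m - c)\<^sup>2 / 2 * ((2 * A + B) / 3) powr (1 / q)"
proof -
  define u where "u = (2 * A + B) / 3"
  define K where "K = (B - A) / (2 * (m - c))"
  define k where "k = 1 / q * u powr (1 / q - 1) * K"
  define z where "z = c + 2 * (m - c) / 3"
  have Ku: "A + K * (t - c) = u + K * (t - z)" for t
    using assms(1) unfolding u_def K_def z_def by (simp add: field_simps)
  have abs: "(\<bar>f' t\<bar> powr q) powr (1 / q) = \<bar>f' t\<bar>" for t
    using assms(2) by (simp add: powr_powr)
  have bd: "\<bar>f' t\<bar> \<le> u powr (1 / q) + k * (t - z)" if t: "t \<in> {c..m}" for t
  proof (cases "u = 0")
    \<comment> \<open>The tangent argument needs a positive base point. If \<open>u = 0\<close>,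
      then \<open>A\<close> and \<open>B\<close> vanish, hence so does \<open>f'\<close> on
      \<open>{c..m}\<close>, and \<open>k = 0\<close> because \<open>0\<close> to any power is
      \<open>0\<close>.\<close>
    case True
    then have "A = 0" "B = 0" using assms unfolding u_def by auto
    then have "\<bar>f' t\<bar> powr q \<le> 0" using le[OF t] by simp
    then show ?thesis using True by (simp add: k_def)
  next
    case False
    then have "u > 0" using assms unfolding u_def by auto
    have le': "\<bar>f' t\<bar> powr q \<le> u + K * (t - z)" using le[OF t] Ku by (simp add: K_def)
    have "\<bar>f' t\<bar> = (\<bar>f' t\<bar> powr q) powr (1 / q)" by (simp add: abs)
    also have "\<dots> \<le> (u + K * (t - z)) powr (1 / q)"
      using le' assms(2) by (intro powr_mono2) auto
    also have "\<dots> \<le> u powr (1 / q) + 1 / q * u powr (1 / q - 1) * (u + K * (t - z) - u)"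
      using \<open>u > 0\<close> assms(2) le' order_trans[OF powr_ge_zero le']
      by (intro powr_le_tangent) auto
    finally show ?thesis by (simp add: k_def mult.assoc)
  qed
  show ?thesis
    using endpoint_error_affine[of c m f f' "u powr (1 / q)" k] assms(1) f bd
    unfolding u_def z_def by auto
qed

lemma add_powr_thirds_le:
  fixes A B p :: real
  assumes "A \<ge> 0" "B \<ge> 0" "p \<ge> 0"
  shows "((2 * A + B) / 3) powr p + ((A + 2 * B) / 3) powr p
    \<le> (1 / 3) powr p * ((A + 3 * B) powr p + (3 * A + B) powr p)"
proof -
  have third: "(w / 3) powr p = (1 / 3) powr p * w powr p" if "w \<ge> 0" for w
    using powr_mult[of "1 / 3" w p] that by simp
  have "(2 * A + B) powr p + (A + 2 * B) powr p \<le> (A + 3 * B) powr p + (3 * A + B) powr p"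
    using powr_mono2[of p "2 * A + B" "3 * A + B"] powr_mono2[of p "A + 2 * B" "A + 3 * B"] assms
    by simp
  then have "(1 / 3) powr p * ((2 * A + B) powr p + (A + 2 * B) powr p)
      \<le> (1 / 3) powr p * ((A + 3 * B) powr p + (3 * A + B) powr p)"
    by (intro mult_left_mono) auto
  then show ?thesis
    using assms third[of "2 * A + B"] third[of "A + 2 * B"] by (simp add: distrib_left)
qed

lemma midpoint_rule_error:
  fixes f f' :: "real \<Rightarrow> real"
  assumes "c < d" "q \<ge> 1"
    and f: "\<And>t. t \<in> {c..d} \<Longrightarrow> (f has_real_derivative f' t) (at t within {c..d})"
    and cvx: "convex_on {c..d} (\<lambda>t. \<bar>f' t\<bar> powr q)"
  shows "\<bar>integral {c..d} f - f ((c + d) / 2) * (d - c)\<bar> \<le> (d - c)\<^sup>2 / 8 *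
    (((2 * \<bar>f' c\<bar> powr q + \<bar>f' d\<bar> powr q) / 3) powr (1 / q) +
     ((\<bar>f' c\<bar> powr q + 2 * \<bar>f' d\<bar> powr q) / 3) powr (1 / q))"
proof -
  define m where "m = (c + d) / 2"
  define A where "A = \<bar>f' c\<bar> powr q"
  define B where "B = \<bar>f' d\<bar> powr q"
  \<comment> \<open>The last two equations identify the denominators of the chord slopes on the two
    halves with \<open>d - c\<close>.\<close>
  have m: "c < m" "m < d" "2 * (m - c) = d - c" "2 * (- m - - d) = d - c"
    using assms(1) by (auto simp: m_def field_simps)
  have L: "\<bar>integral {c..m} f - (m - c) * f m\<bar> \<le> (m - c)\<^sup>2 / 2 * ((2 * A + B) / 3) powr (1 / q)"
  proof (rule endpoint_error_powr[where f' = f'])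
    fix t assume t: "t \<in> {c..m}"
    then have t': "t \<in> {c..d}" using m by auto
    show "(f has_real_derivative f' t) (at t within {c..m})"
      using f[OF t'] m by (rule_tac has_field_derivative_subset) auto
    show "\<bar>f' t\<bar> powr q \<le> A + (B - A) / (2 * (m - c)) * (t - c)"
      using convex_onD_Icc'[OF cvx t'] unfolding m(3) by (simp add: A_def B_def algebra_simps)
  qed (use assms m in \<open>auto simp: A_def B_def\<close>)
  \<comment> \<open>The reflection \<open>t \<mapsto> - t\<close> carries \<open>{m..d}\<close> to
    \<open>{-d..-m}\<close>. The outer endpoint \<open>d\<close> becomes the left one, so the
    left-half estimate applies with \<open>A\<close> and \<open>B\<close> exchanged.\<close>
  have R: "\<bar>integral {-d..-m} (\<lambda>t. f (- t)) - (- m - - d) * f (- (- m))\<bar>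
      \<le> (- m - - d)\<^sup>2 / 2 * ((2 * B + A) / 3) powr (1 / q)"
  proof (rule endpoint_error_powr[where f' = "\<lambda>t. - f' (- t)"])
    fix t assume t: "t \<in> {-d..-m}"
    then have t': "- t \<in> {c..d}" using m by auto
    have "(f has_real_derivative f' (- t)) (at (- t) within uminus ` {-d..-m})"
      using f[OF t'] m by (rule_tac has_field_derivative_subset) auto
    then have "(f \<circ> uminus has_real_derivative f' (- t) * - 1) (at t within {-d..-m})"
      by (intro DERIV_image_chain) (auto intro!: derivative_eq_intros)
    then show "((\<lambda>t. f (- t)) has_real_derivative - f' (- t)) (at t within {-d..-m})"
      by (simp add: o_def)
    \<comment> \<open>The same chord over \<open>{c..d}\<close>, now written from its value at
      \<open>d\<close>.\<close>
    show "\<bar>- f' (- t)\<bar> powr q \<le> B + (A - B) / (2 * (- m - - d)) * (t - - d)"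
      using convex_onD_Icc''[OF cvx t'] unfolding m(4) by (simp add: A_def B_def algebra_simps)
  qed (use assms m in \<open>auto simp: A_def B_def\<close>)
  have "continuous_on {c..d} f"
    using f by (meson DERIV_continuous continuous_on_eq_continuous_within)
  then have "integral {c..m} f + integral {m..d} f = integral {c..d} f"
    using m by (intro Henstock_Kurzweil_Integration.integral_combine
      integrable_continuous_real) auto
  moreover have "(m - c) * f m + (d - m) * f m = f m * (d - c)"
    by (simp add: algebra_simps)
  moreover have sq: "(m - c)\<^sup>2 / 2 = (d - c)\<^sup>2 / 8" "(- m - - d)\<^sup>2 / 2 = (d - c)\<^sup>2 / 8"
    unfolding m_def by (simp_all add: field_simps power2_eq_square)
  moreover have "\<bar>integral {m..d} f - (d - m) * f m\<bar>
      \<le> (d - c)\<^sup>2 / 8 * ((A + 2 * B) / 3) powr (1 / q)"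
    using R unfolding sq by (simp add: add.commute)
  ultimately show ?thesis
    using L unfolding A_def[symmetric] B_def[symmetric] m_def[symmetric] sq distrib_left
    by linarith
qed

lemma division_mono:
  assumes "is_division a b n x" "i \<le> j" "j \<le> n"
  shows "x i \<le> x j"
  using assms(2,3)
proof (induction j rule: dec_induct)
  case (step k)
  then have "x k < x (Suc k)" using assms(1) by (auto simp: is_division_def)
  then show ?case using step by simp
qed simp

lemma integral_division:
  fixes f :: "real \<Rightarrow> real"
  assumes "is_division a b n x" "f integrable_on {a..b}"
  shows "integral {a..b} f = (\<Sum>i<n. integral {x i..x (Suc i)} f)"
proof -
  have ends: "x 0 = a" "x n = b" using assms(1) by (auto simp: is_division_def)
  have "integral {x 0..x j} f = (\<Sum>i<j. integral {x i..x (Suc i)} f)" if "j \<le> n" for j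
    using that
  proof (induction j)
    case (Suc j)
    have le: "x 0 \<le> x j" "x j \<le> x (Suc j)" "x (Suc j) \<le> x n"
      using Suc.prems by (auto intro!: division_mono[OF assms(1)])
    have "f integrable_on {x 0..x (Suc j)}"
      using assms(2) le ends by (auto intro: integrable_subinterval_real)
    then show ?case
      using Suc Henstock_Kurzweil_Integration.integral_combine[OF le(1,2), of f] by simp
  qed simp
  from this[of n] show ?thesis by (simp add: ends)
qed

theorem proposition6:
  fixes I :: "real set" and a b q :: real and f f' :: "real \<Rightarrow> real"
    and n :: nat and x :: "nat \<Rightarrow> real"
  assumes "is_interval I" and "I \<subseteq> {0..}"
    and "a \<in> I" and "b \<in> I" and "a < b"
    and "\<And>t. t \<in> interior I \<union> {a, b} \<Longrightarrow> (f has_real_derivative f' t) (at t within I)"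
    and "f' absolutely_integrable_on {a..b}"
    and "q \<ge> 1"
    and "convex_on {a..b} (\<lambda>t. \<bar>f' t\<bar> powr q)"
    and "is_division a b n x"
  shows "\<bar>midpoint_error f n x\<bar> \<le> 1 / 8 * (1 / 3) powr (1 / q) *
    (\<Sum>i<n. (x (Suc i) - x i)\<^sup>2 *
       ((\<bar>f' (x i)\<bar> powr q + 3 * \<bar>f' (x (Suc i))\<bar> powr q) powr (1 / q) +
        (3 * \<bar>f' (x i)\<bar> powr q + \<bar>f' (x (Suc i))\<bar> powr q) powr (1 / q)))"
proof -
  note div = \<open>is_division a b n x\<close>
  have ends: "x 0 = a" "x n = b" using div by (auto simp: is_division_def)
  have sub: "{a..b} \<subseteq> I"
    using mem_is_interval_1_I[OF assms(1,3,4)] by auto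
  \<comment> \<open>Hence the differentiability hypothesis covers all of \<open>{a..b}\<close>;
    restricting the derivatives from \<open>I\<close> to \<open>{a..b}\<close> makes those at
    \<open>a\<close> and \<open>b\<close> one-sided.\<close>
  have "{a<..<b} \<subseteq> interior I"
    using sub by (intro interior_maximal) auto
  then have "t \<in> interior I \<union> {a, b}" if "t \<in> {a..b}" for t
    using that by force
  then have D: "(f has_real_derivative f' t) (at t within {a..b})" if "t \<in> {a..b}" for t
    using assms(6) sub that by (blast intro: has_field_derivative_subset)
  then have "continuous_on {a..b} f"
    by (meson DERIV_continuous continuous_on_eq_continuous_within)
  then have "integral {x 0..x n} f = (\<Sum>i<n. integral {x i..x (Suc i)} f)"
    unfolding ends by (intro integral_division[OF div] integrable_continuous_real)
  then have "\<bar>midpoint_error f n x\<bar> =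
      \<bar>\<Sum>i<n. integral {x i..x (Suc i)} f - f ((x i + x (Suc i)) / 2) * (x (Suc i) - x i)\<bar>"
    by (simp add: midpoint_error_def midpoint_sum_def sum_subtractf)
  also have "\<dots> \<le> (\<Sum>i<n. \<bar>integral {x i..x (Suc i)} f
      - f ((x i + x (Suc i)) / 2) * (x (Suc i) - x i)\<bar>)"
    by (rule sum_abs)
  \<comment> \<open>The constant stays inside the sum so that each subinterval can be estimated
    separately.\<close>
  also have "\<dots> \<le> (\<Sum>i<n. 1 / 8 * (1 / 3) powr (1 / q) * ((x (Suc i) - x i)\<^sup>2 *
       ((\<bar>f' (x i)\<bar> powr q + 3 * \<bar>f' (x (Suc i))\<bar> powr q) powr (1 / q) +
        (3 * \<bar>f' (x i)\<bar> powr q + \<bar>f' (x (Suc i))\<bar> powr q) powr (1 / q))))"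
  proof (rule sum_mono)
    fix i assume "i \<in> {..<n}"
    then have i: "i < n" by simp
    let ?c = "x i" and ?d = "x (Suc i)"
    let ?A = "\<bar>f' ?c\<bar> powr q" and ?B = "\<bar>f' ?d\<bar> powr q"
    have "?c < ?d" using div i by (auto simp: is_division_def)
    have cd: "{?c..?d} \<subseteq> {a..b}"
      using division_mono[OF div, of 0 i] division_mono[OF div, of "Suc i" n] i ends by auto
    have "\<bar>integral {?c..?d} f - f ((?c + ?d) / 2) * (?d - ?c)\<bar> \<le> (?d - ?c)\<^sup>2 / 8 *
        (((2 * ?A + ?B) / 3) powr (1 / q) + ((?A + 2 * ?B) / 3) powr (1 / q))"
    proof (rule midpoint_rule_error[OF \<open>?c < ?d\<close> \<open>q \<ge> 1\<close>])
      show "(f has_real_derivative f' t) (at t within {?c..?d})" if "t \<in> {?c..?d}" for t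
        using D cd that by (blast intro: has_field_derivative_subset)
      show "convex_on {?c..?d} (\<lambda>t. \<bar>f' t\<bar> powr q)"
        using assms(9) cd by (rule convex_on_subset) simp
    qed
    \<comment> \<open>Here the weights 2 and 1 from the barycentre are relaxed to the 3 and 1 of the
      claim.\<close>
    also have "\<dots> \<le> (?d - ?c)\<^sup>2 / 8 *
        ((1 / 3) powr (1 / q) * ((?A + 3 * ?B) powr (1 / q) + (3 * ?A + ?B) powr (1 / q)))"
      using \<open>q \<ge> 1\<close> by (intro mult_left_mono add_powr_thirds_le) auto
    finally show "\<bar>integral {?c..?d} f - f ((?c + ?d) / 2) * (?d - ?c)\<bar>
      \<le> 1 / 8 * (1 / 3) powr (1 / q) * ((?d - ?c)\<^sup>2 *
        ((?A + 3 * ?B) powr (1 / q) + (3 * ?A + ?B) powr (1 / q)))"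
      by (simp add: mult_ac)
  qed
  finally show ?thesis by (simp add: sum_distrib_left)
qed

end
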